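(* Let $G$ be a tripartite graph on $n$ vertices. Then \[t_{\max}(G)\ge\begin{cases}\frac{3}{2}\left(e(G)-\frac{n^2}{4}\right) & \text{if } \frac{e(G)}{n^2}<\frac{3}{10},\\[4pt] e(G)-\frac{2}{9}n^2 & \text{if } \frac{3}{10}\le \frac{e(G)}{n^2}\le\frac{1}{3}.\end{cases}\]
   Context: For a graph $G$, the triangle-degree of a vertex $x$ is the number of triangles of $G$ containing $x$, and $t_{\max}(G)$ denotes the maximum triangle-degree over all vertices of $G$. A graph is tripartite if its vertex set can be partitioned into three independent sets. *)

theory Defs
  imports Complex_Main "HOL-Library.Ramsey"
begin

text \<open>
  A finite simple graph is given by a vertex set \<open>V\<close> and a set \<open>E\<close> of two-element subsets of \<open>V\<close>,
  so that \<open>e(G)\<close> is \<open>card E\<close>. This fits the predicates \<^const>\<open>clique\<close> and \<^const>\<open>indep\<close> of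
  \<^theory>\<open>HOL-Library.Ramsey\<close>.
\<close>

definition simple_graph :: "'a set \<Rightarrow> 'a set set \<Rightarrow> bool" where
  "simple_graph V E \<longleftrightarrow> finite V \<and> E \<subseteq> [V]\<^bsup>2\<^esup>"

text \<open>
  The parts may be empty; in particular, bipartite graphs are tripartite.
\<close>

definition tripartite :: "'a set \<Rightarrow> 'a set set \<Rightarrow> bool" where
  "tripartite V E \<longleftrightarrow>
     (\<exists>A B C. A \<union> B \<union> C = V \<and> A \<inter> B = {} \<and> A \<inter> C = {} \<and> B \<inter> C = {} \<and>
        indep A E \<and> indep B E \<and> indep C E)"

definition triangles :: "'a set \<Rightarrow> 'a set set \<Rightarrow> 'a set set" where
  "triangles V E = {T \<in> [V]\<^bsup>3\<^esup>. clique T E}"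

definition triangle_degree :: "'a set \<Rightarrow> 'a set set \<Rightarrow> 'a \<Rightarrow> nat" where
  "triangle_degree V E x = card {T \<in> triangles V E. x \<in> T}"

text \<open>
  For \<open>V = {}\<close> the maximum is over the empty set and has no specified value.
\<close>

definition t_max :: "'a set \<Rightarrow> 'a set set \<Rightarrow> nat" where
  "t_max V E = Max (triangle_degree V E ` V)"

end

theory Submission
  imports Defs
begin

text \<open>
  Let \<open>a \<le> b \<le> c\<close> be the sizes of the parts. Of the \<open>a * b * c\<close> transversal triples, each of the
  \<open>a * b + b * c + c * a - e\<close> non-adjacent pairs between parts destroys at most \<open>c\<close>, so there are at
  least \<open>c * (e - c * (a + b))\<close> triangles. Each contains exactly one of the \<open>a\<close> vertices of
  the smallest part, so some vertex there has triangle-degree at least \<open>(c / a) * (e - c * (a + b))\<close>.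
  As \<open>2 * a \<le> n - c\<close>, both bounds follow by minimising over \<open>c \<ge> n / 3\<close>.
\<close>

section \<open>Counting triangles and edges across the parts\<close>

lemma triangle_degree_le_t_max:
  assumes "finite V" "x \<in> V"
  shows "triangle_degree V E x \<le> t_max V E"
  using assms by (simp add: t_max_def)

text \<open>The map \<open>(y, z)\<close> to \<open>{x, y, z}\<close> is injective: disjointness of
  \<open>B\<close>, \<open>C\<close> and \<open>{x}\<close> lets \<open>y\<close> and
  \<open>z\<close> be read off from the triangle.\<close>

lemma card_transversal_le_triangle_degree:
  assumes V: "finite V" "B \<subseteq> V" "C \<subseteq> V" "x \<in> V"
    and disj: "x \<notin> B" "x \<notin> C" "B \<inter> C = {}"
  shows "card {(y, z) \<in> B \<times> C. {x, y} \<in> E \<and> {x, z} \<in> E \<and> {y, z} \<in> E} \<le> triangle_degree V E x"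
    (is "card ?P \<le> _")
proof -
  let ?f = "\<lambda>(y, z). {x, y, z}"
  have "inj_on ?f ?P"
    using disj by (auto simp: inj_on_def doubleton_eq_iff insert_eq_iff set_eq_iff)
  moreover have "?f ` ?P \<subseteq> {T \<in> triangles V E. x \<in> T}"
  proof clarify
    fix y z
    assume yz: "y \<in> B" "z \<in> C" and E: "{x, y} \<in> E" "{x, z} \<in> E" "{y, z} \<in> E"
    have "x \<noteq> y" "x \<noteq> z" "y \<noteq> z"
      using yz disj by auto
    then have "{x, y, z} \<in> [V]\<^bsup>3\<^esup>"
      using yz V by (auto simp: nsets_def)
    moreover have "clique {x, y, z} E"
      using E by (auto simp: clique_def insert_commute)
    ultimately show "{x, y, z} \<in> triangles V E \<and> x \<in> {x, y, z}"
      by (simp add: triangles_def)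
  qed
  moreover have "finite {T \<in> triangles V E. x \<in> T}"
    by (rule finite_subset[of _ "Pow V"]) (use V in \<open>auto simp: triangles_def nsets_def\<close>)
  ultimately show ?thesis
    unfolding triangle_degree_def by (rule card_inj_on_le)
qed

lemma card_edges_le_cross_pairs:
  assumes E: "E \<subseteq> [A \<union> B \<union> C]\<^bsup>2\<^esup>" and fin: "finite A" "finite B" "finite C"
    and ind: "indep A E" "indep B E" "indep C E"
  shows "card E \<le> card {(x, y) \<in> A \<times> B. {x, y} \<in> E} + card {(x, z) \<in> A \<times> C. {x, z} \<in> E}
           + card {(y, z) \<in> B \<times> C. {y, z} \<in> E}" (is "_ \<le> card ?AB + card ?AC + card ?BC")
proof -
  let ?f = "\<lambda>(u, v). {u, v}"
  have finP: "finite (?AB \<union> ?AC \<union> ?BC)"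
    by (rule finite_subset[of _ "A \<times> B \<union> A \<times> C \<union> B \<times> C"]) (use fin in auto)
  have "E \<subseteq> ?f ` (?AB \<union> ?AC \<union> ?BC)"
  proof
    fix e assume e: "e \<in> E"
    then obtain u v where uv: "e = {u, v}" "u \<noteq> v" "u \<in> A \<union> B \<union> C" "v \<in> A \<union> B \<union> C"
      using E by (auto simp: nsets_def card_2_iff)
    have mem: "{u', v'} \<in> ?f ` (?AB \<union> ?AC \<union> ?BC)"
      if "(u', v') \<in> ?AB \<union> ?AC \<union> ?BC" for u' v'
      using that by (rule image_eqI[rotated]) simp
    have "{u, v} \<in> E" "{v, u} \<in> E"
      using e uv by (simp_all add: insert_commute)
    \<comment> \<open>Independence puts the two ends of an edge in different parts, so one of its
      two orientations follows the order \<open>A\<close>, \<open>B\<close>,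
      \<open>C\<close>.\<close>
    then have "(u, v) \<in> ?AB \<union> ?AC \<union> ?BC \<or> (v, u) \<in> ?AB \<union> ?AC \<union> ?BC"
      using uv ind unfolding indep_def by blast
    then show "e \<in> ?f ` (?AB \<union> ?AC \<union> ?BC)"
      using mem[of u v] mem[of v u] uv(1) by (metis insert_commute)
  qed
  then have "card E \<le> card (?AB \<union> ?AC \<union> ?BC)"
    by (rule surj_card_le[OF finP])
  also have "\<dots> \<le> card ?AB + card ?AC + card ?BC"
    by (meson card_Un_le add_le_mono1 le_trans)
  finally show ?thesis .
qed

lemma card_filter_add:
  assumes "finite S"
  shows "card {p \<in> S. P p} + card {p \<in> S. \<not> P p} = card S"
proof -
  have "card ({p \<in> S. P p} \<union> {p \<in> S. \<not> P p}) = card {p \<in> S. P p} + card {p \<in> S. \<not> P p}"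
    by (rule card_Un_disjoint) (use assms in auto)
  moreover have "{p \<in> S. P p} \<union> {p \<in> S. \<not> P p} = S"
    by auto
  ultimately show ?thesis by simp
qed

text \<open>Union bound over the missing pairs: a transversal triple that is not a triangle contains
  one, and each lies in at most \<open>card C\<close> triples. With part sizes \<open>a\<close>,
  \<open>b\<close>, \<open>c\<close> and \<open>e\<close> edges, the term \<open>a * b * c\<close>
  cancels in \<open>a * b * c - c * (a * b + a * c + b * c - e)\<close>, leaving
  \<open>c * e - c\<^sup>2 * (a + b)\<close>. The additive form avoids truncated subtraction on
  \<open>nat\<close>.\<close>

lemma edges_le_triangles_tripartite:
  assumes fin: "finite A" "finite B" "finite C"
    and E: "E \<subseteq> [A \<union> B \<union> C]\<^bsup>2\<^esup>"
    and ind: "indep A E" "indep B E" "indep C E"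
    and le: "card A \<le> card C" "card B \<le> card C"
  shows "card C * card E \<le>
           card {(x, y, z) \<in> A \<times> B \<times> C. {x, y} \<in> E \<and> {x, z} \<in> E \<and> {y, z} \<in> E}
             + (card C)\<^sup>2 * (card A + card B)"
proof -
  define a b c where "a = card A" and "b = card B" and "c = card C"
  let ?T = "{(x, y, z) \<in> A \<times> B \<times> C. {x, y} \<in> E \<and> {x, z} \<in> E \<and> {y, z} \<in> E}"
  define MAB where "MAB = {(x, y) \<in> A \<times> B. {x, y} \<notin> E}"
  define MAC where "MAC = {(x, z) \<in> A \<times> C. {x, z} \<notin> E}"
  define MBC where "MBC = {(y, z) \<in> B \<times> C. {y, z} \<notin> E}"
  have finM: "finite MAB" "finite MAC" "finite MBC"
    using fin by (auto simp: MAB_def MAC_def MBC_def intro: finite_subset[of _ "_ \<times> _"])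
  have split: "card {(u, v) \<in> X \<times> Y. {u, v} \<in> E} + card {(u, v) \<in> X \<times> Y. {u, v} \<notin> E} = card X * card Y"
    if "finite X" "finite Y" for X Y
    using card_filter_add[of "X \<times> Y" "\<lambda>(u, v). {u, v} \<in> E"] that
    by (simp add: card_cartesian_product case_prod_unfold mem_Times_iff conj_assoc)
  have M: "card E + (card MAB + card MAC + card MBC) \<le> a * b + a * c + b * c"
    using card_edges_le_cross_pairs[OF E fin ind] split[of A B] split[of A C] split[of B C] fin
    by (simp add: MAB_def MAC_def MBC_def a_def b_def c_def)
  \<comment> \<open>The three sets collect the triples spoiled by a missing pair; the letter names
    the part from which the third vertex is free.\<close>
  let ?XC = "(\<lambda>((x, y), z). (x, y, z)) ` (MAB \<times> C)"
  let ?XB = "(\<lambda>((x, z), y). (x, y, z)) ` (MAC \<times> B)"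
  let ?XA = "A \<times> MBC"
  have "A \<times> B \<times> C \<subseteq> ?T \<union> (?XC \<union> ?XB \<union> ?XA)"
    by (auto simp: MAB_def MAC_def MBC_def image_iff)
  moreover have "finite ?T"
    by (rule finite_subset[of _ "A \<times> B \<times> C"]) (use fin in auto)
  ultimately have "card (A \<times> B \<times> C) \<le> card (?T \<union> (?XC \<union> ?XB \<union> ?XA))"
    using fin finM by (intro card_mono) auto
  also have "\<dots> \<le> card ?T + (card ?XC + card ?XB + card ?XA)"
    by (meson card_Un_le add_le_mono add_le_mono1 le_trans order_refl)
  also have "\<dots> \<le> card ?T + (card MAB * c + card MAC * b + card MBC * a)"
  proof -
    have "card ?XC \<le> card MAB * c"
      using card_image_le[of "MAB \<times> C" "\<lambda>((x, y), z). (x, y, z)"] finM fin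
      by (simp add: card_cartesian_product c_def)
    moreover have "card ?XB \<le> card MAC * b"
      using card_image_le[of "MAC \<times> B" "\<lambda>((x, z), y). (x, y, z)"] finM fin
      by (simp add: card_cartesian_product b_def)
    moreover have "card ?XA = card MBC * a"
      by (simp add: card_cartesian_product a_def)
    ultimately show ?thesis by linarith
  qed
  \<comment> \<open>A common factor \<open>c\<close> leaves only the total number of missing pairs,
    which \<open>M\<close> controls through the number of edges.\<close>
  also have "\<dots> \<le> card ?T + (card MAB * c + card MAC * c + card MBC * c)"
    using le by (intro add_mono mult_le_mono) (auto simp: a_def b_def c_def)
  finally have "a * b * c \<le> card ?T + c * (card MAB + card MAC + card MBC)"
    by (simp add: card_cartesian_product a_def b_def c_def algebra_simps)
  moreover have "c * (card E + (card MAB + card MAC + card MBC)) \<le> c * (a * b + a * c + b * c)"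
    using M by (rule mult_le_mono2)
  ultimately have "c * card E \<le> card ?T + c\<^sup>2 * (a + b)"
    by (simp add: algebra_simps power2_eq_square)
  then show ?thesis
    by (simp add: a_def b_def c_def)
qed

text \<open>Averaging over \<open>A\<close>: grouping the transversal triangles by their vertex in
  \<open>A\<close> gives \<open>card A\<close> groups, each of size at most \<open>t_max\<close>.
  The estimate is strongest when \<open>A\<close> is the smallest part.\<close>

lemma edges_le_t_max_tripartite:
  assumes fin: "finite A" "finite B" "finite C"
    and disj: "A \<inter> B = {}" "A \<inter> C = {}" "B \<inter> C = {}"
    and E: "E \<subseteq> [A \<union> B \<union> C]\<^bsup>2\<^esup>"
    and ind: "indep A E" "indep B E" "indep C E"
    and le: "card A \<le> card C" "card B \<le> card C"
  shows "card C * card E \<le> card A * t_max (A \<union> B \<union> C) E + (card C)\<^sup>2 * (card A + card B)"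
proof -
  let ?P = "\<lambda>x. {(y, z) \<in> B \<times> C. {x, y} \<in> E \<and> {x, z} \<in> E \<and> {y, z} \<in> E}"
  have "{(x, y, z) \<in> A \<times> B \<times> C. {x, y} \<in> E \<and> {x, z} \<in> E \<and> {y, z} \<in> E} = (SIGMA x:A. ?P x)"
    by auto
  moreover have "finite (?P x)" for x
    by (rule finite_subset[of _ "B \<times> C"]) (use fin in auto)
  ultimately have "card {(x, y, z) \<in> A \<times> B \<times> C. {x, y} \<in> E \<and> {x, z} \<in> E \<and> {y, z} \<in> E}
      = (\<Sum>x\<in>A. card (?P x))"
    using fin by (simp add: card_SigmaI)
  also have "\<dots> \<le> (\<Sum>x\<in>A. t_max (A \<union> B \<union> C) E)"
  proof (rule sum_mono)
    fix x assume x: "x \<in> A"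
    have "card (?P x) \<le> triangle_degree (A \<union> B \<union> C) E x"
      using x fin disj by (intro card_transversal_le_triangle_degree) auto
    also have "\<dots> \<le> t_max (A \<union> B \<union> C) E"
      using x fin by (intro triangle_degree_le_t_max) auto
    finally show "card (?P x) \<le> t_max (A \<union> B \<union> C) E" .
  qed
  finally show ?thesis
    using edges_le_triangles_tripartite[OF fin E ind le] by simp
qed

lemma tripartite_ordered_parts:
  assumes "tripartite V E"
  obtains A B C where "A \<union> B \<union> C = V" "A \<inter> B = {}" "A \<inter> C = {}" "B \<inter> C = {}"
    "indep A E" "indep B E" "indep C E" "card A \<le> card B" "card B \<le> card C"
proof -
  obtain A B C where ABC: "A \<union> B \<union> C = V" "A \<inter> B = {}" "A \<inter> C = {}" "B \<inter> C = {}"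
      "indep A E" "indep B E" "indep C E"
    using assms by (auto simp: tripartite_def)
  consider "card A \<le> card B" "card B \<le> card C" | "card A \<le> card C" "card C \<le> card B"
    | "card B \<le> card A" "card A \<le> card C" | "card B \<le> card C" "card C \<le> card A"
    | "card C \<le> card A" "card A \<le> card B" | "card C \<le> card B" "card B \<le> card A"
    by linarith
  then show thesis
  proof cases
    case 1 then show thesis using that[of A B C] ABC by blast
  next
    case 2 then show thesis using that[of A C B] ABC by blast
  next
    case 3 then show thesis using that[of B A C] ABC by blast
  next
    case 4 then show thesis using that[of B C A] ABC by blast
  next
    case 5 then show thesis using that[of C A B] ABC by blast
  next
    case 6 then show thesis using that[of C B A] ABC by blast
  qed
qed

section \<open>Minimisation over the size of the largest part\<close>

text \<open>Here \<open>c\<close> is the size of the largest part and \<open>s\<close> that of the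
  other two together, so that \<open>s + c\<close> is the number of vertices. Multiplied by
  \<open>s\<close> and combined with \<open>key\<close>, the claim reduces to nonnegativity of an
  expression affine in \<open>e\<close>. It is enough to check the end of the range from
  \<open>(s + c)\<^sup>2 / 4\<close> to \<open>3 / 10 * (s + c)\<^sup>2\<close> where it is
  smallest, which depends on the sign of the slope \<open>2 * c - 3 / 2 * s\<close>.\<close>

lemma low_density_bound:
  fixes c e s t :: real
  assumes s: "0 < s" "s \<le> 2 * c" and t: "0 \<le> t"
    and key: "2 * c * e \<le> s * t + 2 * c\<^sup>2 * s"
    and e: "e \<le> 3 / 10 * (s + c)\<^sup>2"
  shows "3 / 2 * (e - (s + c)\<^sup>2 / 4) \<le> t"
proof (cases "e \<le> (s + c)\<^sup>2 / 4")
  case True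
  then have "3 / 2 * (e - (s + c)\<^sup>2 / 4) \<le> 0" by simp
  then show ?thesis using t by linarith
next
  case False
  have "0 \<le> e * (2 * c - 3 / 2 * s) - 2 * c\<^sup>2 * s + 3 / 8 * s * (s + c)\<^sup>2"
  proof (cases "3 / 2 * s \<le> 2 * c")
    case True
    \<comment> \<open>Value of the affine expression at the lower end; it vanishes when the largest
      part has half of the vertices.\<close>
    have "0 \<le> c / 2 * (c - s)\<^sup>2"
      using s by simp
    also have "\<dots> = (s + c)\<^sup>2 / 4 * (2 * c - 3 / 2 * s) - 2 * c\<^sup>2 * s + 3 / 8 * s * (s + c)\<^sup>2"
      by (simp add: power2_eq_square field_simps)
    also have "(s + c)\<^sup>2 / 4 * (2 * c - 3 / 2 * s) \<le> e * (2 * c - 3 / 2 * s)"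
      using True False by (intro mult_right_mono) auto
    finally show ?thesis by simp
  next
    case ge: False
    \<comment> \<open>The constraint \<open>s \<le> 2 * c\<close> becomes \<open>w \<ge> 0\<close>,
      and the value at the upper end becomes a cubic in \<open>w\<close> and \<open>s\<close> with
      only positive coefficients.\<close>
    define w where "w = c - s / 2"
    have w: "0 \<le> w" "c = s / 2 + w"
      using s by (auto simp: w_def)
    have "0 \<le> 3 / 5 * w ^ 3 + 1 / 40 * w\<^sup>2 * s + 1 / 40 * w * s\<^sup>2 + 1 / 160 * s ^ 3"
      using w s by simp
    also have "\<dots> = 3 / 10 * (s + c)\<^sup>2 * (2 * c - 3 / 2 * s) - 2 * c\<^sup>2 * s + 3 / 8 * s * (s + c)\<^sup>2"
      unfolding w(2) by (simp add: power2_eq_square power3_eq_cube field_simps)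
    also have "3 / 10 * (s + c)\<^sup>2 * (2 * c - 3 / 2 * s) \<le> e * (2 * c - 3 / 2 * s)"
      using e ge by (intro mult_right_mono_neg) auto
    finally show ?thesis by simp
  qed
  then have "s * (3 / 2 * (e - (s + c)\<^sup>2 / 4)) \<le> s * t"
    using key by (simp add: algebra_simps)
  then show ?thesis using s by simp
qed

text \<open>Again the claim times \<open>s\<close> reduces to an expression affine in
  \<open>e\<close>. Its slope \<open>2 * c - s\<close> is now never negative, so the lower end
  \<open>e = 3 / 10 * (s + c)\<^sup>2\<close> is the worst case.\<close>

lemma high_density_bound:
  fixes c e s t :: real
  assumes s: "0 < s" "s \<le> 2 * c"
    and key: "2 * c * e \<le> s * t + 2 * c\<^sup>2 * s"
    and e: "3 / 10 * (s + c)\<^sup>2 \<le> e"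
  shows "e - 2 / 9 * (s + c)\<^sup>2 \<le> t"
proof -
  define w where "w = c - s / 2"
  have w: "0 \<le> w" "c = s / 2 + w"
    using s by (auto simp: w_def)
  \<comment> \<open>The constant \<open>2 / 9\<close> is the one that cancels the
    \<open>s ^ 3\<close> term: the expression vanishes at \<open>w = 0\<close>, where the largest
    part has a third of the vertices.\<close>
  have "0 \<le> 1 / 60 * w * s\<^sup>2 + 1 / 45 * w\<^sup>2 * s + 3 / 5 * w ^ 3"
    using w s by simp
  also have "\<dots> = 3 / 10 * (s + c)\<^sup>2 * (2 * c - s) - 2 * c\<^sup>2 * s + 2 / 9 * s * (s + c)\<^sup>2"
    unfolding w(2) by (simp add: power2_eq_square power3_eq_cube field_simps)
  also have "3 / 10 * (s + c)\<^sup>2 * (2 * c - s) \<le> e * (2 * c - s)"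
    using e s by (intro mult_right_mono) auto
  finally have "s * (e - 2 / 9 * (s + c)\<^sup>2) \<le> s * t"
    using key by (simp add: algebra_simps)
  then show ?thesis using s by simp
qed

theorem theorem1p6:
  fixes V :: "'a set" and E :: "'a set set" and n :: nat
  assumes "simple_graph V E"
    and "tripartite V E"
    and "card V = n"
  shows "(real (card E) / (real n)\<^sup>2 < 3 / 10 \<longrightarrow>
            real (t_max V E) \<ge> 3 / 2 * (real (card E) - (real n)\<^sup>2 / 4)) \<and>
         (3 / 10 \<le> real (card E) / (real n)\<^sup>2 \<and> real (card E) / (real n)\<^sup>2 \<le> 1 / 3 \<longrightarrow>
            real (t_max V E) \<ge> real (card E) - 2 / 9 * (real n)\<^sup>2)"
proof -
  obtain A B C where V: "A \<union> B \<union> C = V" and disj: "A \<inter> B = {}" "A \<inter> C = {}" "B \<inter> C = {}"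
    and ind: "indep A E" "indep B E" "indep C E" and le: "card A \<le> card B" "card B \<le> card C"
    using tripartite_ordered_parts[OF assms(2)] .
  have finV: "finite V" and EV: "E \<subseteq> [V]\<^bsup>2\<^esup>"
    using assms(1) by (auto simp: simple_graph_def)
  then have fin: "finite A" "finite B" "finite C"
    using V by (auto intro: finite_subset)
  have n: "n = card A + card B + card C"
    using disj fin by (simp add: assms(3)[symmetric] V[symmetric] card_Un_disjoint Int_Un_distrib2)
  have "card C * card E \<le> card A * t_max V E + (card C)\<^sup>2 * (card A + card B)"
    using edges_le_t_max_tripartite[OF fin disj _ ind] EV le by (simp add: V)
  then have key: "real (card C) * card E
      \<le> real (card A) * t_max V E + (real (card C))\<^sup>2 * (real (card A) + card B)"
    unfolding of_nat_add[symmetric] of_nat_mult[symmetric] of_nat_power[symmetric] of_nat_le_iff .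
  define s where "s = real (card A) + card B"
  define c where "c = real (card C)"
  have nsc: "real n = s + c"
    by (simp add: n s_def c_def)
  show ?thesis
  \<comment> \<open>If \<open>s = 0\<close>, all vertices lie in the independent part
    \<open>C\<close>, so there are no edges and both lower bounds are at most 0. This includes
    \<open>n = 0\<close>, where the quotient is 0 by convention and \<open>t_max\<close> is an
    unspecified natural number.\<close>
  proof (cases "s = 0")
    case True
    have "E = {}"
    proof (rule equals0I)
      fix e assume e: "e \<in> E"
      have "card A = 0" "card B = 0"
        using True by (simp_all add: s_def add_nonneg_eq_0_iff)
      then have "V = C"
        using fin V by simp
      then show False
        using e EV ind(3) by (force simp: nsets_def card_2_iff indep_def)
    qed
    then show ?thesis
      by (auto intro: order_trans[OF _ of_nat_0_le_iff])
  next
    case False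
    then have s: "0 < s" "s \<le> 2 * c"
      using le by (auto simp: s_def c_def)
    \<comment> \<open>The smaller of the first two parts has at most half of their total; this
      eliminates \<open>card A\<close> and leaves an inequality in \<open>s\<close> and
      \<open>c\<close> alone.\<close>
    have "real (card A) * t_max V E \<le> s / 2 * t_max V E"
      using le by (intro mult_right_mono) (auto simp: s_def)
    then have key': "2 * c * card E \<le> s * t_max V E + 2 * c\<^sup>2 * s"
      using key by (simp add: s_def c_def algebra_simps)
    have "0 < (s + c)\<^sup>2"
      using s by simp
    then show ?thesis
      using low_density_bound[OF s _ key'] high_density_bound[OF s key']
      by (simp add: nsc divide_less_eq le_divide_eq)
  qed
qed

end
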